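(* Let $d \ge 3$ and let $H_d = \operatorname{conv}\{\mathbf{p} \in \{0,1\}^d : p_1 + \cdots + p_d \text{ even}\}$ be the halfcube. Then every pulling triangulation of $H_d$ (with respect to any partial order on its vertices in which every nonempty face has a unique minimal vertex) has the same number of simplices, and this number equals \[ t(d) = \sum_{l=3}^{d} \frac{d!}{l!}\left(2^{l-1} - l\right). \]
   Context: For $d \ge 3$, $H_d$ is a $d$-dimensional polytope in $\mathbb{R}^d$. Pulling triangulations: let $P$ be a polytope and $\preceq$ a partial order on its vertex set such that for every nonempty face $F$ of $P$ the vertices of $F$ have a unique minimal element $\mathbf{v}_F$ with respect to $\preceq$. The pulling triangulation $\mathrm{Pull}_\preceq(P)$ is defined recursively: if $P$ is a simplex, $\mathrm{Pull}_\preceq(P) = \{P\}$; otherwise $\mathrm{Pull}_\preceq(P) = \bigcup_F \{ \operatorname{conv}(Q \cup \{\mathbf{v}_P\}) : Q \in \mathrm{Pull}_\preceq(F)\}$, where the union is over all facets $F$ of $P$ not containing $\mathbf{v}_P$ (the recursion applies to facets, which are polytopes in their own affine hulls, with the restricted order). The number of simplices is $|\mathrm{Pull}_\preceq(P)|$. *)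

theory Defs
  imports "HOL-Analysis.Analysis"
begin

definition vertices :: "'a::euclidean_space set \<Rightarrow> 'a set" where
  "vertices P = {v. v extreme_point_of P}"

definition minimal_vertex :: "'a::euclidean_space rel \<Rightarrow> 'a set \<Rightarrow> 'a \<Rightarrow> bool" where
  "minimal_vertex r F v \<longleftrightarrow>
     v \<in> vertices F \<and> (\<forall>w\<in>vertices F. (w, v) \<in> r \<longrightarrow> w = v)"

text \<open>
  Here \<open>(v, w) \<in> r\<close> means that \<open>v\<close> precedes or equals \<open>w\<close>. The faces in the sense of
  \<^const>\<open>face_of\<close> include \<open>P\<close> itself.
\<close>

definition pulling_order :: "'a::euclidean_space set \<Rightarrow> 'a rel \<Rightarrow> bool" where
  "pulling_order P r \<longleftrightarrow>
     partial_order_on (vertices P) r \<and>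
     (\<forall>F. F face_of P \<and> F \<noteq> {} \<longrightarrow> (\<exists>!v. minimal_vertex r F v))"

definition pulled_vertex :: "'a::euclidean_space rel \<Rightarrow> 'a set \<Rightarrow> 'a" where
  "pulled_vertex r F = (THE v. minimal_vertex r F v)"

text \<open>
  Since \<^const>\<open>minimal_vertex\<close> compares only vertices of \<open>F\<close>, the order need not be restricted
  explicitly in the recursive call.
\<close>

function pull :: "'a::euclidean_space rel \<Rightarrow> 'a set \<Rightarrow> 'a set set" where
  "pull r P =
     (if \<exists>n. n simplex P then {P}
      else \<Union>F\<in>{F. F facet_of P \<and> pulled_vertex r P \<notin> F}.
             {convex hull (Q \<union> {pulled_vertex r P}) | Q. Q \<in> pull r F})"
  by pat_completeness auto
termination
proof (relation "Wellfounded.measure (\<lambda>(r, P). nat (aff_dim P + 1))")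
  show "wf (Wellfounded.measure (\<lambda>(r :: 'a rel, P :: 'a set). nat (aff_dim P + 1)))"
    by simp
next
  fix r :: "'a rel" and P F :: "'a set"
  assume "F \<in> {F. F facet_of P \<and> pulled_vertex r P \<notin> F}"
  then have "aff_dim F = aff_dim P - 1" "F \<noteq> {}"
    by (auto simp: facet_of_def)
  moreover from \<open>F \<noteq> {}\<close> have "aff_dim F \<ge> 0"
    using aff_dim_negative_iff[of F] by linarith
  ultimately show "((r, F), (r, P)) \<in> Wellfounded.measure (\<lambda>(r, P). nat (aff_dim P + 1))"
    by simp
qed

declare pull.simps [simp del]

text \<open>
  Parity is expressed through a natural number, because \<open>2 dvd x\<close> holds for every real \<open>x\<close>.
\<close>

definition halfcube :: "(real ^ 'n) set" where
  "halfcube = convex hull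
     {p. (\<forall>i. p $ i \<in> {0, 1}) \<and> (\<exists>m::nat. even m \<and> (\<Sum>i\<in>UNIV. p $ i) = real m)}"

end

theory Submission
  imports Defs
begin

text \<open>
  Coning the simplices of the pulling triangulations of the facets that avoid the pulled vertex
  never identifies two of them: the base of a cone is recovered from its extreme points, and it
  spans the affine hull of its facet. Hence the number of simplices is additive over these facets.

  The halfcube of dimension \<open>k \<ge> 4\<close> has \<open>2k\<close> facets \<open>x\<^sub>i = 0\<close>, \<open>x\<^sub>i = 1\<close>, which are halfcubes
  of dimension \<open>k - 1\<close>, and \<open>2\<^sup>k\<^sup>-\<^sup>1\<close> simplices, spanned by the \<open>k\<close> neighbours of each cube vertex of
  the opposite parity. A vertex is avoided by \<open>k\<close> of the former and by \<open>2\<^sup>k\<^sup>-\<^sup>1 - k\<close> of the latter, so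
  \<open>t k = k * t (k - 1) + 2\<^sup>k\<^sup>-\<^sup>1 - k\<close> for every order, with \<open>t 3 = 1\<close> for the tetrahedron.
  The induction runs over the faces of one fixed cube, so that no affine isomorphisms are needed.
\<close>

subsection \<open>Counting simplices of pulling triangulations\<close>

text \<open>The part of \<open>pulling_order\<close> that passes to faces, since a face of a face is
  a face. It is the hypothesis carried through the recursion of \<open>pull\<close>.\<close>

definition unique_minima :: "'a::euclidean_space rel \<Rightarrow> 'a set \<Rightarrow> bool" where
  "unique_minima r P \<longleftrightarrow> (\<forall>F. F face_of P \<and> F \<noteq> {} \<longrightarrow> (\<exists>!v. minimal_vertex r F v))"

lemma unique_minima_face:
  assumes "unique_minima r P" "F face_of P"
  shows "unique_minima r F"
  unfolding unique_minima_def
proof (intro allI impI)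
  fix G assume "G face_of F \<and> G \<noteq> {}"
  then have "G face_of P \<and> G \<noteq> {}" using face_of_trans[OF _ assms(2)] by blast
  then show "\<exists>!v. minimal_vertex r G v"
    using assms(1) unfolding unique_minima_def by (elim allE impE)
qed

lemma pulled_vertex_extreme:
  assumes "unique_minima r P" "convex P" "P \<noteq> {}"
  shows "pulled_vertex r P extreme_point_of P"
proof -
  have "\<exists>!v. minimal_vertex r P v"
    using assms by (simp add: unique_minima_def face_of_refl)
  then have "minimal_vertex r P (pulled_vertex r P)"
    unfolding pulled_vertex_def by (rule theI')
  then show ?thesis
    by (simp add: minimal_vertex_def vertices_def)
qed

text \<open>A point of the cone lying in \<open>F\<close> but outside \<open>Q\<close> would be
  interior to a segment from \<open>v\<close> to a point of \<open>Q\<close>, and the face property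
  would then put \<open>v\<close> into \<open>F\<close>. So the base is recovered from the cone and
  the face.\<close>

lemma cone_Int_face:
  fixes v :: "'a::real_normed_vector"
  assumes F: "F face_of P" and "Q \<subseteq> F" "convex Q" "v \<in> P" "v \<notin> F"
  shows "convex hull (insert v Q) \<inter> F = Q"
proof
  show "Q \<subseteq> convex hull (insert v Q) \<inter> F"
    using \<open>Q \<subseteq> F\<close> hull_subset[of "insert v Q" convex] by auto
  show "convex hull (insert v Q) \<inter> F \<subseteq> Q"
  proof
    fix x assume x: "x \<in> convex hull (insert v Q) \<inter> F"
    then have "x \<noteq> v" "x \<in> F" using \<open>v \<notin> F\<close> by auto
    show "x \<in> Q"
    proof (cases "Q = {}")
      case True then show ?thesis using x \<open>v \<notin> F\<close> by auto
    next
      case False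
      then obtain u b where u: "0 \<le> u" "u \<le> 1" and b: "b \<in> Q" and xe: "x = (1 - u) *\<^sub>R v + u *\<^sub>R b"
        using x \<open>convex Q\<close> by (auto simp: convex_hull_insert_alt hull_same)
      show ?thesis
      proof (cases "u = 1")
        case True then show ?thesis using xe b by simp
      next
        case False
        have "u \<noteq> 0" using xe \<open>x \<noteq> v\<close> by auto
        moreover have "v \<noteq> b" using b assms by auto
        ultimately have "x \<in> open_segment v b"
          using u False xe unfolding in_segment by (intro conjI exI[of _ u]) auto
        moreover have "b \<in> P" using b \<open>Q \<subseteq> F\<close> face_of_imp_subset[OF F] by auto
        ultimately have "v \<in> F"
          using F \<open>x \<in> F\<close> \<open>v \<in> P\<close> unfolding face_of_def by blast
        with \<open>v \<notin> F\<close> show ?thesis by simp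
      qed
    qed
  qed
qed

text \<open>\<open>F\<close> is the intersection of \<open>P\<close> with the affine hull of
  \<open>F\<close>, so the apex lies outside that hull and coning adds exactly one
  dimension.\<close>

lemma aff_dim_cone_facet:
  assumes "F facet_of P" "convex P" "Q \<subseteq> F" "aff_dim Q = aff_dim F" "v \<in> P" "v \<notin> F"
  shows "aff_dim (convex hull (insert v Q)) = aff_dim P"
proof -
  have F: "F face_of P" and d: "aff_dim F = aff_dim P - 1" using assms(1) by (auto simp: facet_of_def)
  have "affine hull Q = affine hull F"
    using assms(3,4) by (simp add: aff_dim_eq_full_gen)
  moreover have "v \<notin> affine hull F"
    using face_of_imp_eq_affine_Int[OF \<open>convex P\<close> F] assms(5,6) by blast
  ultimately show ?thesis
    using d assms(4) by (simp add: aff_dim_convex_hull aff_dim_insert)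
qed

text \<open>\<open>Q'\<close> is a face of the common cone, so its extreme points are extreme in the
  cone and belong to \<open>insert v Q\<close>. None of them is \<open>v\<close>, and Krein-Milman
  gives the inclusion. For two polytopes, exchanging the roles makes the bases equal.\<close>

lemma cone_eq_subset:
  fixes v :: "'a::euclidean_space"
  assumes "convex P"
    and F: "F face_of P" "Q \<subseteq> F" "v \<in> P" "v \<notin> F"
    and F': "F' face_of P" "Q' \<subseteq> F'" "v \<notin> F'"
    and Q': "convex Q" "polytope Q'"
    and eq: "convex hull (insert v Q) = convex hull (insert v Q')"
  shows "Q' \<subseteq> Q"
proof -
  let ?S = "convex hull (insert v Q)"
  have "convex Q'" "compact Q'" using Q' by (auto simp: polytope_imp_convex polytope_imp_compact)
  have S': "?S \<inter> F' = Q'"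
    using cone_Int_face[OF F'(1,2) \<open>convex Q'\<close> F(3) F'(3)] eq by simp
  have "?S \<subseteq> P"
    using F face_of_imp_subset[OF F(1)] \<open>convex P\<close> by (intro hull_minimal) auto
  then have "Q' face_of ?S"
    using face_of_slice[OF F'(1), of ?S] S' by (simp add: Int_absorb1 Int_commute)
  then have "x \<in> Q" if "x extreme_point_of Q'" for x
    using that F'(2,3) extreme_point_of_convex_hull[of x "insert v Q"]
    by (auto simp: extreme_point_of_face)
  then have "convex hull {x. x extreme_point_of Q'} \<subseteq> Q"
    using \<open>convex Q\<close> by (intro hull_minimal) auto
  then show ?thesis
    using Krein_Milman_Minkowski[OF \<open>compact Q'\<close> \<open>convex Q'\<close>] by simp
qed

lemma pull_simplex: "n simplex P \<Longrightarrow> pull r P = {P}"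
  unfolding pull.simps[of r P] by (rule if_P) (rule exI)

lemma pull_not_simplex:
  assumes "\<nexists>n. n simplex P"
  shows "pull r P = (\<Union>F\<in>{F. F facet_of P \<and> pulled_vertex r P \<notin> F}.
           (\<lambda>Q. convex hull (insert (pulled_vertex r P) Q)) ` pull r F)"
proof -
  have "pull r P = (\<Union>F\<in>{F. F facet_of P \<and> pulled_vertex r P \<notin> F}.
      {convex hull (Q \<union> {pulled_vertex r P}) | Q. Q \<in> pull r F})"
    using pull.simps[of r P] unfolding if_not_P[OF assms] .
  then show ?thesis by (simp only: Setcompr_eq_image Un_insert_right Un_empty_right)
qed

text \<open>Induction along the recursion of \<open>pull\<close>. The equality of dimensions is what
  later prevents cones over different facets from coinciding.\<close>

lemma pull_mem:
  assumes "polytope P" "unique_minima r P" "Q \<in> pull r P"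
  shows "polytope Q \<and> Q \<subseteq> P \<and> aff_dim Q = aff_dim P"
  using assms
proof (induction r P arbitrary: Q rule: pull.induct)
  case (1 r P)
  show ?case
  proof (cases "\<exists>n. n simplex P")
    case True
    then show ?thesis using 1 by (auto simp: pull_simplex)
  next
    case False
    let ?v = "pulled_vertex r P"
    obtain F Q' where F: "F facet_of P" "?v \<notin> F" and Q': "Q' \<in> pull r F"
      and Q: "Q = convex hull (insert ?v Q')"
      using "1.prems"(3) unfolding pull_not_simplex[OF False] by auto
    have face: "F face_of P" using F facet_of_imp_face_of by blast
    have "P \<noteq> {}" using False simplex_empty by blast
    have "convex P" using 1 polytope_imp_convex by blast
    then have v: "?v \<in> P"
      using pulled_vertex_extreme[of r P] 1 \<open>P \<noteq> {}\<close> by (auto simp: extreme_point_of_def)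
    have IH: "polytope Q' \<and> Q' \<subseteq> F \<and> aff_dim Q' = aff_dim F"
      using "1.IH"[OF _ _ _ _ Q'] False F "1.prems"(1,2) unique_minima_face[OF _ face]
        face_of_polytope_polytope[OF _ face] by blast
    have "polytope Q"
      \<comment> \<open>Coning over the hull of a finite set amounts to adding the apex to that
        set.\<close>
      using IH unfolding Q by (metis hull_insert finite_insert polytope_def)
    moreover have "Q \<subseteq> P"
      unfolding Q using v IH face_of_imp_subset[OF face] \<open>convex P\<close> by (intro hull_minimal) auto
    moreover have "aff_dim Q = aff_dim P"
      unfolding Q using aff_dim_cone_facet F \<open>convex P\<close> IH v by blast
    ultimately show ?thesis by blast
  qed
qed

lemma card_pull:
  assumes "polytope P" "unique_minima r P" and ns: "\<nexists>n. n simplex P"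
    and fin: "\<And>F. F facet_of P \<Longrightarrow> pulled_vertex r P \<notin> F \<Longrightarrow> finite (pull r F)"
  defines "\<F> \<equiv> {F. F facet_of P \<and> pulled_vertex r P \<notin> F}"
  shows "finite (pull r P)" "card (pull r P) = (\<Sum>F\<in>\<F>. card (pull r F))"
proof -
  let ?v = "pulled_vertex r P" and ?c = "\<lambda>Q. convex hull (insert (pulled_vertex r P) Q)"
  have pull: "pull r P = (\<Union>F\<in>\<F>. ?c ` pull r F)"
    unfolding \<F>_def by (rule pull_not_simplex[OF ns])
  have finF: "finite \<F>"
    using finite_polytope_facets[OF assms(1)] unfolding \<F>_def by simp
  have fin': "finite (pull r F)" if "F \<in> \<F>" for F using fin that by (simp add: \<F>_def)
  show "finite (pull r P)" unfolding pull using finF fin' by blast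
  have "P \<noteq> {}" using ns simplex_empty by blast
  have conv: "convex P" using assms polytope_imp_convex by blast
  then have v: "?v \<in> P"
    using pulled_vertex_extreme[of r P] assms \<open>P \<noteq> {}\<close> by (auto simp: extreme_point_of_def)
  have faces: "F face_of P" "?v \<notin> F" if "F \<in> \<F>" for F
    using that facet_of_imp_face_of by (auto simp: \<F>_def)
  have mem: "polytope Q \<and> Q \<subseteq> F \<and> aff_dim Q = aff_dim F" if "F \<in> \<F>" "Q \<in> pull r F" for F Q
    using that faces assms(1,2) pull_mem[of F r Q] unique_minima_face face_of_polytope_polytope by blast
  have eq: "Q' \<subseteq> Q" if "F \<in> \<F>" "F' \<in> \<F>" "Q \<in> pull r F" "Q' \<in> pull r F'" "?c Q = ?c Q'" for F F' Q Q'
    using cone_eq_subset[OF conv faces(1)[OF that(1)] _ v faces(2)[OF that(1)] faces(1)[OF that(2)]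
        _ faces(2)[OF that(2)] _ _ that(5)] mem[OF that(1,3)] mem[OF that(2,4)] polytope_imp_convex by blast
  have "card (pull r P) = (\<Sum>F\<in>\<F>. card (?c ` pull r F))"
    unfolding pull
  proof (rule card_UN_disjoint[OF finF])
    show "\<forall>F\<in>\<F>. finite (?c ` pull r F)" using fin' by blast
    show "\<forall>F\<in>\<F>. \<forall>F'\<in>\<F>. F \<noteq> F' \<longrightarrow> ?c ` pull r F \<inter> ?c ` pull r F' = {}"
    proof (intro ballI impI)
      fix F F' assume F: "F \<in> \<F>" "F' \<in> \<F>" "F \<noteq> F'"
      \<comment> \<open>A common cone puts \<open>Q'\<close> inside both facets. As
        \<open>Q'\<close> has the dimension of \<open>F'\<close>, the face
        \<open>F \<inter> F'\<close> of \<open>F'\<close> has full dimension and is all of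
        \<open>F'\<close>.\<close>
      have sub: "F' \<subseteq> F" if "Q \<in> pull r F" "Q' \<in> pull r F'" "?c Q = ?c Q'" "F \<in> \<F>" "F' \<in> \<F>" for F F' Q Q'
      proof -
        have "Q' \<subseteq> F \<inter> F'" using eq[of F F' Q Q'] that mem by blast
        then have "aff_dim F' \<le> aff_dim (F \<inter> F')" using mem that aff_dim_subset by metis
        moreover have "F \<inter> F' face_of F'"
          using faces that by (meson face_of_Int face_of_subset inf_le2 face_of_imp_subset)
        ultimately have "F \<inter> F' = F'"
          using face_of_aff_dim_lt[of F' "F \<inter> F'"] face_of_imp_convex[OF faces(1)[OF that(5)]] by force
        then show ?thesis by blast
      qed
      show "?c ` pull r F \<inter> ?c ` pull r F' = {}"
      proof (rule ccontr)
        assume "?c ` pull r F \<inter> ?c ` pull r F' \<noteq> {}"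
        then obtain Q Q' where Q: "Q \<in> pull r F" "Q' \<in> pull r F'" "?c Q = ?c Q'" by blast
        then have "F' \<subseteq> F" "F \<subseteq> F'" using sub F by metis+
        with F show False by blast
      qed
    qed
  qed
  also have "\<dots> = (\<Sum>F\<in>\<F>. card (pull r F))"
  proof (rule sum.cong[OF refl])
    fix F assume "F \<in> \<F>"
    \<comment> \<open>Within a single facet the inclusion \<open>eq\<close> applies in both
      directions.\<close>
    then have "inj_on ?c (pull r F)"
      using eq by (intro inj_onI) (rule subset_antisym; auto)
    then show "card (?c ` pull r F) = card (pull r F)" by (rule card_image)
  qed
  finally show "card (pull r P) = (\<Sum>F\<in>\<F>. card (pull r F))" .
qed

subsection \<open>Hulls of cube vertices\<close>

definition cube_vertex :: "'n::finite set \<Rightarrow> real ^ 'n" where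
  "cube_vertex A = (\<chi> i. if i \<in> A then 1 else 0)"

text \<open>On cube vertices this linear functional is, up to an additive constant, the Hamming
  distance to \<open>cube_vertex A\<close>.\<close>

definition signs :: "'n::finite set \<Rightarrow> real ^ 'n" where
  "signs A = (\<chi> i. if i \<in> A then -1 else 1)"

text \<open>
  The cube vertices of the face with free coordinates \<open>J\<close> whose remaining coordinates are given by
  \<open>C\<close>; the parity is that of the whole vertex, not of its part in \<open>J\<close>.
\<close>

definition parity_class :: "bool \<Rightarrow> 'n::finite set \<Rightarrow> 'n set \<Rightarrow> 'n set set" where
  "parity_class b J C = {A. A - J = C \<and> even (card A) = b}"

definition nbrs :: "'n::finite set \<Rightarrow> 'n set \<Rightarrow> 'n set set" where
  "nbrs J W = (\<lambda>i. sym_diff W {i}) ` J"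

abbreviation cube_hull :: "'n::finite set set \<Rightarrow> (real ^ 'n) set" where
  "cube_hull S \<equiv> convex hull (cube_vertex ` S)"

lemma cube_vertex_nth [simp]: "cube_vertex A $ i = (if i \<in> A then 1 else 0)"
  by (simp add: cube_vertex_def)

lemma inner_cube_vertex:
  fixes A :: "'n::finite set"
  shows "a \<bullet> cube_vertex A = (\<Sum>i\<in>A. a $ i)"
proof -
  have "a \<bullet> cube_vertex A = (\<Sum>i\<in>UNIV. if i \<in> A then a $ i else 0)"
    unfolding inner_vec_def by (intro sum.cong) auto
  then show ?thesis by (simp add: sum.If_cases)
qed

lemma signs_cube_vertex: "signs A \<bullet> cube_vertex B + real (card A) = real (card (sym_diff A B))"
proof -
  have "card (sym_diff A B) = card (A - B) + card (B - A)"
    by (rule card_Un_disjoint) auto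
  moreover have "card A = card (A \<inter> B) + card (A - B)"
    using card_Un_disjoint[of "A \<inter> B" "A - B"] by (simp add: Int_Diff_Un disjoint_iff)
  moreover have "signs A \<bullet> cube_vertex B = real (card (B - A)) - real (card (A \<inter> B))"
    unfolding inner_cube_vertex signs_def by (simp add: sum.If_cases Int_commute Diff_eq)
  ultimately show ?thesis by simp
qed

lemma even_card_sym_diff:
  fixes A B :: "'n::finite set"
  shows "even (card (sym_diff A B)) \<longleftrightarrow> (even (card A) \<longleftrightarrow> even (card B))"
proof -
  have "card (sym_diff A B) = card (A - B) + card (B - A)"
    by (rule card_Un_disjoint) auto
  moreover have "card A = card (A \<inter> B) + card (A - B)"
    using card_Un_disjoint[of "A \<inter> B" "A - B"] by (simp add: Int_Diff_Un disjoint_iff)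
  moreover have "card B = card (A \<inter> B) + card (B - A)"
    using card_Un_disjoint[of "B \<inter> A" "B - A"]
    by (metis Int_Diff_Un Int_Diff_disjoint Int_commute finite)
  ultimately show ?thesis by auto
qed

text \<open>Cube vertices are in convex position: \<open>signs A\<close> attains its minimum over
  them at \<open>A\<close> alone, and every other one exceeds that minimum by at least 1.\<close>

lemma cube_vertex_mem_cube_hull: "cube_vertex A \<in> cube_hull S \<longleftrightarrow> A \<in> S"
proof
  assume mem: "cube_vertex A \<in> cube_hull S"
  show "A \<in> S"
  proof (rule ccontr)
    assume "A \<notin> S"
    have "signs A \<bullet> cube_vertex B \<ge> 1 - real (card A)" if "B \<in> S" for B
    proof -
      have "sym_diff A B \<noteq> {}" using that \<open>A \<notin> S\<close> by auto
      then have "card (sym_diff A B) \<ge> 1" by (simp add: Suc_le_eq card_gt_0_iff del: Un_empty)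
      then show ?thesis using signs_cube_vertex[of A B] by linarith
    qed
    then have "cube_hull S \<subseteq> {x. signs A \<bullet> x \<ge> 1 - real (card A)}"
      by (intro hull_minimal convex_halfspace_ge) auto
    then show False using mem signs_cube_vertex[of A A] by auto
  qed
qed (simp add: hull_inc)

lemma inj_cube_vertex: "inj cube_vertex"
proof (rule injI)
  fix A B :: "'a set" assume "cube_vertex A = cube_vertex B"
  then show "A = B" using cube_vertex_mem_cube_hull[of A "{B}"] by simp
qed

text \<open>This turns comparisons of polytopes into comparisons of families of finite sets, the
  form in which facets are handled from here on.\<close>

lemma cube_hull_subset_iff: "cube_hull S \<subseteq> cube_hull T \<longleftrightarrow> S \<subseteq> T"
proof
  assume sub: "cube_hull S \<subseteq> cube_hull T"
  show "S \<subseteq> T"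
  proof
    fix A assume "A \<in> S"
    then have "cube_vertex A \<in> cube_hull S" by (simp only: cube_vertex_mem_cube_hull)
    then have "cube_vertex A \<in> cube_hull T" using sub by (rule rev_subsetD)
    then show "A \<in> T" by (simp only: cube_vertex_mem_cube_hull)
  qed
qed (intro hull_mono image_mono)

lemma cube_hull_eq_iff: "cube_hull S = cube_hull T \<longleftrightarrow> S = T"
  by (simp only: set_eq_subset cube_hull_subset_iff)

lemma polytope_cube_hull: "polytope (cube_hull S)"
  unfolding polytope_def by (intro exI[of _ "cube_vertex ` S"]) simp

lemma face_of_cube_hull:
  assumes "F face_of cube_hull S"
  shows "F = cube_hull {A \<in> S. cube_vertex A \<in> F}"
proof -
  obtain S' where "S' \<subseteq> cube_vertex ` S" "F = convex hull S'"
    by (rule face_of_convex_hull_subset[OF _ assms]) (auto intro: finite_imp_compact)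
  then obtain T where T: "T \<subseteq> S" "F = cube_hull T" by (metis subset_imageE)
  then have "{A \<in> S. cube_vertex A \<in> F} = T" by (auto simp: cube_vertex_mem_cube_hull)
  then show ?thesis using T by simp
qed

text \<open>By Krein-Milman the extreme points already span the hull, and a family of cube vertices
  is determined by its hull.\<close>

lemma extreme_point_of_cube_hull: "x extreme_point_of cube_hull S \<longleftrightarrow> x \<in> cube_vertex ` S"
proof
  show "x extreme_point_of cube_hull S \<Longrightarrow> x \<in> cube_vertex ` S" by (rule extreme_point_of_convex_hull)
  have "{x. x extreme_point_of cube_hull S} \<subseteq> cube_vertex ` S" using extreme_point_of_convex_hull by blast
  then obtain T where T: "{x. x extreme_point_of cube_hull S} = cube_vertex ` T" by (metis subset_imageE)
  have "cube_hull S = cube_hull T"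
    using Krein_Milman_Minkowski[of "cube_hull S"] T by (simp add: finite_imp_compact_convex_hull)
  then have "S = T" by (simp add: cube_hull_eq_iff)
  then show "x \<in> cube_vertex ` S \<Longrightarrow> x extreme_point_of cube_hull S" using T by auto
qed

lemma cube_hull_supporting_face:
  assumes "\<And>A. A \<in> S \<Longrightarrow> a \<bullet> cube_vertex A \<ge> b"
  shows "cube_hull {A \<in> S. a \<bullet> cube_vertex A = b} face_of cube_hull S"
proof -
  have "cube_hull S \<subseteq> {x. a \<bullet> x \<ge> b}"
    using assms by (intro hull_minimal convex_halfspace_ge) auto
  then have f: "(cube_hull S \<inter> {x. a \<bullet> x = b}) face_of cube_hull S"
    by (intro face_of_Int_supporting_hyperplane_ge) auto
  have "{A \<in> S. cube_vertex A \<in> cube_hull S \<inter> {x. a \<bullet> x = b}} = {A \<in> S. a \<bullet> cube_vertex A = b}"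
    by (auto simp: cube_vertex_mem_cube_hull)
  then show ?thesis using face_of_cube_hull[OF f] f by simp
qed

section \<open>Parity classes and neighbours: independence, dimension, cardinality\<close>

lemma parity_class_flip:
  assumes "W \<in> parity_class b J C" "D \<subseteq> J" "odd (card D)"
  shows "sym_diff W D \<in> parity_class (\<not> b) J C"
proof -
  have "sym_diff W D - J = W - J" using assms(2) by blast
  moreover have "even (card (sym_diff W D)) = (\<not> even (card W))"
    using assms(3) unfolding even_card_sym_diff by blast
  ultimately show ?thesis using assms(1) unfolding parity_class_def by blast
qed

lemma parity_class_sym_diff:
  assumes "A \<in> parity_class b J C" "B \<in> parity_class b' J C"
  shows "sym_diff A B \<subseteq> J" "even (card (sym_diff A B)) = (b = b')"
proof -
  show "sym_diff A B \<subseteq> J" using assms by (auto simp: parity_class_def)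
  show "even (card (sym_diff A B)) = (b = b')"
    using assms unfolding even_card_sym_diff parity_class_def by blast
qed

lemma nbrs_subset:
  assumes "W \<in> parity_class b J C"
  shows "nbrs J W \<subseteq> parity_class (\<not> b) J C"
proof
  fix A assume "A \<in> nbrs J W"
  then obtain i where "i \<in> J" "A = sym_diff W {i}" unfolding nbrs_def by blast
  then show "A \<in> parity_class (\<not> b) J C" using parity_class_flip[OF assms, of "{i}"] by simp
qed

lemma mem_nbrs_iff: "A \<in> nbrs J W \<longleftrightarrow> (\<exists>i\<in>J. sym_diff A W = {i})"
proof -
  have "A = sym_diff W {i} \<longleftrightarrow> sym_diff A W = {i}" for i by blast
  then show ?thesis unfolding nbrs_def by blast
qed

text \<open>Neighbours are the vertices at Hamming distance one; agreement outside \<open>J\<close>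
  forces the flipped coordinate into \<open>J\<close>.\<close>

lemma mem_nbrs_card:
  assumes "A - J = W - J"
  shows "A \<in> nbrs J W \<longleftrightarrow> card (sym_diff W A) = 1"
proof -
  have "sym_diff W A = sym_diff A W" "sym_diff A W \<subseteq> J" using assms by blast+
  then show ?thesis unfolding mem_nbrs_iff One_nat_def card_1_singleton_iff by (metis insert_subset)
qed

lemma card_nbrs: "card (nbrs J W) = card J"
proof -
  have "i = j" if "sym_diff W {i} = sym_diff W {j}" for i j using that by blast
  then have "inj_on (\<lambda>i. sym_diff W {i}) J" by (rule inj_onI)
  then show ?thesis unfolding nbrs_def by (rule card_image)
qed

text \<open>In coordinate \<open>j\<close> of \<open>J\<close>, the neighbour obtained by flipping
  \<open>j\<close> differs from all the others, which agree with \<open>W\<close> there. With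
  coefficients summing to zero, that coordinate of a dependence reads \<open>u j = 0\<close> up to
  sign.\<close>

lemma affine_independent_nbrs:
  fixes W :: "'n::finite set"
  shows "\<not> affine_dependent (cube_vertex ` nbrs J W)"
proof
  assume "affine_dependent (cube_vertex ` nbrs J W)"
  then obtain U where U: "sum U (cube_vertex ` nbrs J W) = 0" "\<exists>v\<in>cube_vertex ` nbrs J W. U v \<noteq> 0"
    "(\<Sum>v\<in>cube_vertex ` nbrs J W. U v *\<^sub>R v) = 0"
    by (auto simp: affine_dependent_explicit_finite)
  define f where "f i = (cube_vertex (sym_diff W {i}) :: real ^ 'n)" for i
  have im: "cube_vertex ` nbrs J W = f ` J" by (auto simp: nbrs_def f_def)
  have inj: "inj_on f J"
  proof (rule inj_onI)
    fix i j assume "f i = f j"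
    then have "sym_diff W {i} = sym_diff W {j}" unfolding f_def by (rule injD[OF inj_cube_vertex])
    then show "i = j" by blast
  qed
  define u where "u i = U (f i)" for i
  have s: "(\<Sum>i\<in>J. u i) = 0" and v: "(\<Sum>i\<in>J. u i *\<^sub>R f i) = 0"
    using U inj by (auto simp: im sum.reindex u_def)
  have "u j = 0" if "j \<in> J" for j
  proof -
    have "0 = (\<Sum>i\<in>J. u i *\<^sub>R f i) $ j" using v by simp
    also have "\<dots> = (\<Sum>i\<in>J. u i * f i $ j)" by simp
    also have "\<dots> = (if j \<in> W then sum u J - u j else u j)"
    proof (cases "j \<in> W")
      case True
      have "(\<Sum>i\<in>J. u i * f i $ j) = (\<Sum>i\<in>J. u i - (if i = j then u i else 0))"
        using True by (intro sum.cong) (auto simp: f_def)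
      also have "\<dots> = sum u J - u j" using that by (simp add: sum_subtractf)
      finally show ?thesis using True by simp
    next
      case False
      have "(\<Sum>i\<in>J. u i * f i $ j) = (\<Sum>i\<in>J. if i = j then u i else 0)"
        using False by (intro sum.cong) (auto simp: f_def)
      then show ?thesis using that False by simp
    qed
    finally show ?thesis using s by (auto split: if_splits)
  qed
  then show False using U(2) by (auto simp: im u_def)
qed

lemma aff_dim_nbrs: "aff_dim (cube_hull (nbrs J W)) = int (card J) - 1"
proof -
  have "card (cube_vertex ` nbrs J W) = card J"
    using card_image[OF inj_on_subset[OF inj_cube_vertex]] card_nbrs[of J W] by (metis subset_UNIV)
  then show ?thesis
    using aff_dim_affine_independent[OF affine_independent_nbrs[of J W]]
    unfolding aff_dim_convex_hull by simp
qed

lemma parity_class_nonempty: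
  assumes "C \<inter> J = {}" "J \<noteq> {}"
  obtains A where "A \<in> parity_class b J C"
proof -
  obtain i where "i \<in> J" using assms by auto
  then have "C \<in> parity_class b J C \<or> insert i C \<in> parity_class b J C"
    using assms by (auto simp: parity_class_def card_insert_if)
  then show thesis using that by auto
qed

text \<open>From above, the hull lies in a translate of the coordinate subspace of \<open>J\<close>.
  From below, the neighbours of a vertex \<open>W\<close> of the other parity span a hyperplane of
  that translate, and a further vertex of the class lies off it.\<close>

lemma aff_dim_parity_class:
  assumes C: "C \<inter> J = {}" and J: "card J \<ge> 3"
  shows "aff_dim (cube_hull (parity_class b J C)) = int (card J)"
proof (rule antisym)
  let ?S = "cube_hull (parity_class b J C)"
  have "J \<noteq> {}" using J by auto
  obtain W where W: "W \<in> parity_class (\<not> b) J C" using parity_class_nonempty[OF C \<open>J \<noteq> {}\<close>] .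
  let ?V = "{x :: real ^ 'a. \<forall>i. i \<notin> J \<longrightarrow> x $ i = 0}"
  have sub: "subspace ?V" by (auto simp: subspace_def)
  have "convex ((+) (cube_vertex C) ` ?V)" by (intro convex_translation subspace_imp_convex sub)
  moreover have "cube_vertex ` parity_class b J C \<subseteq> (+) (cube_vertex C) ` ?V"
  proof
    fix x assume "x \<in> cube_vertex ` parity_class b J C"
    then obtain A where A: "x = cube_vertex A" "A - J = C" by (auto simp: parity_class_def)
    then have "x - cube_vertex C \<in> ?V" by auto
    then show "x \<in> (+) (cube_vertex C) ` ?V" by (metis (no_types, lifting) add_diff_cancel_left' diff_add_cancel add.commute image_iff)
  qed
  ultimately have "?S \<subseteq> (+) (cube_vertex C) ` ?V" by (intro hull_minimal)
  then have "aff_dim ?S \<le> aff_dim ((+) (cube_vertex C) ` ?V)" by (rule aff_dim_subset)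
  also have "\<dots> = int (card J)"
    using sub dim_substandard_cart[of J, where 'a=real]
    by (simp add: aff_dim_translation_eq aff_dim_subspace dim_vec_eq del: aff_dim_translation_eq_subtract)
  finally show "aff_dim ?S \<le> int (card J)" .
  \<comment> \<open>Three flips of \<open>W\<close> reach the required parity at distance 3, whereas
    all the neighbours are at distance 1; this is where \<open>card J \<ge> 3\<close>
    enters.\<close>
  obtain D where D: "D \<subseteq> J" "card D = 3" using J by (meson obtain_subset_with_card_n)
  have A: "sym_diff W D \<in> parity_class b J C" using parity_class_flip[OF W D(1)] D by simp
  let ?h = "{x. signs W \<bullet> x = 1 - real (card W)}"
  have "signs W \<bullet> cube_vertex B = 1 - real (card W)" if "B \<in> nbrs J W" for B
  proof -
    have "B - J = W - J" using that by (auto simp: nbrs_def)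
    then have "card (sym_diff W B) = 1" using that mem_nbrs_card by blast
    then show ?thesis using signs_cube_vertex[of W B] by simp
  qed
  then have "affine hull (cube_vertex ` nbrs J W) \<subseteq> ?h"
    by (intro hull_minimal affine_hyperplane) auto
  moreover have "cube_vertex (sym_diff W D) \<notin> ?h"
  proof -
    have "sym_diff W (sym_diff W D) = D" by blast
    then show ?thesis using signs_cube_vertex[of W "sym_diff W D"] D by simp
  qed
  ultimately have "cube_vertex (sym_diff W D) \<notin> affine hull (cube_vertex ` nbrs J W)" by blast
  then have "aff_dim (insert (cube_vertex (sym_diff W D)) (cube_vertex ` nbrs J W)) = int (card J)"
    using aff_dim_nbrs[of J W] by (simp add: aff_dim_insert aff_dim_convex_hull)
  moreover have "insert (cube_vertex (sym_diff W D)) (cube_vertex ` nbrs J W) \<subseteq> cube_vertex ` parity_class b J C"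
    using A nbrs_subset[OF W] by auto
  ultimately show "int (card J) \<le> aff_dim ?S"
    by (metis aff_dim_convex_hull aff_dim_subset)
qed

text \<open>One free coordinate \<open>i\<close> is determined by the parity, and the others may be
  chosen freely.\<close>

lemma card_parity_class:
  assumes C: "C \<inter> J = {}" and J: "J \<noteq> {}"
  shows "card (parity_class b J C) = 2 ^ (card J - 1)"
proof -
  obtain i where i: "i \<in> J" using J by auto
  let ?g = "\<lambda>A. A \<inter> (J - {i})"
  have "bij_betw ?g (parity_class b J C) (Pow (J - {i}))"
    unfolding bij_betw_def
  proof
    show "inj_on ?g (parity_class b J C)"
    proof (rule inj_onI)
      fix A B assume *: "A \<in> parity_class b J C" "B \<in> parity_class b J C" "?g A = ?g B"
      then have "sym_diff A B \<subseteq> {i}" by (auto simp: parity_class_def)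
      moreover have "sym_diff A B \<noteq> {i}" using parity_class_sym_diff(2)[OF *(1,2)] by auto
      ultimately have "sym_diff A B = {}" by blast
      then show "A = B" by blast
    qed
    show "?g ` parity_class b J C = Pow (J - {i})"
    proof (intro subset_antisym subsetI)
      fix D assume "D \<in> Pow (J - {i})"
      then have D: "D \<subseteq> J" "i \<notin> D" by auto
      have "i \<notin> C \<union> D" using i D C by auto
      then have "even (card (insert i (C \<union> D))) = odd (card (C \<union> D))" by simp
      then obtain A where "A = C \<union> D \<or> A = insert i (C \<union> D)" "even (card A) = b" by blast
      then have "A \<in> parity_class b J C" "?g A = D" using i D C by (auto simp: parity_class_def)
      then show "D \<in> ?g ` parity_class b J C" by blast
    qed auto
  qed
  then show ?thesis using i by (simp add: bij_betw_same_card card_Pow)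
qed

subsection \<open>Facets of halfcubes\<close>

text \<open>The vertices with \<open>x_i = 0\<close> or \<open>x_i = 1\<close> again form a parity
  class, with the same \<open>b\<close> because parity refers to the whole vertex. This is what lets
  the induction stay inside one cube.\<close>

lemma parity_class_remove:
  assumes "i \<in> J" "C \<inter> J = {}"
  shows "parity_class b (J - {i}) C = {A \<in> parity_class b J C. i \<notin> A}"
    and "parity_class b (J - {i}) (insert i C) = {A \<in> parity_class b J C. i \<in> A}"
proof -
  have "A - (J - {i}) = C \<longleftrightarrow> A - J = C \<and> i \<notin> A" for A using assms by blast
  then show "parity_class b (J - {i}) C = {A \<in> parity_class b J C. i \<notin> A}" unfolding parity_class_def by blast
  have "A - (J - {i}) = insert i C \<longleftrightarrow> A - J = C \<and> i \<in> A" for A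
  proof
    assume eq: "A - (J - {i}) = insert i C"
    have "A - J = A - (J - {i}) - {i}" using assms by blast
    then show "A - J = C \<and> i \<in> A" using eq assms by auto
  next
    assume "A - J = C \<and> i \<in> A"
    then show "A - (J - {i}) = insert i C" by blast
  qed
  then show "parity_class b (J - {i}) (insert i C) = {A \<in> parity_class b J C. i \<in> A}" unfolding parity_class_def by blast
qed

lemma inner_axis_cube_vertex: "axis i (c::real) \<bullet> cube_vertex A = (if i \<in> A then c else 0)"
  by (simp add: inner_axis')

lemma face_of_parity_class:
  "cube_hull {A \<in> parity_class b J C. i \<notin> A} face_of cube_hull (parity_class b J C)"
  "cube_hull {A \<in> parity_class b J C. i \<in> A} face_of cube_hull (parity_class b J C)"
proof -
  have *: "{A \<in> S. axis i (1::real) \<bullet> cube_vertex A = 0} = {A \<in> S. i \<notin> A}"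
    "{A \<in> S. axis i (-1::real) \<bullet> cube_vertex A = -1} = {A \<in> S. i \<in> A}" for S
    by (auto simp: inner_axis_cube_vertex)
  show "cube_hull {A \<in> parity_class b J C. i \<notin> A} face_of cube_hull (parity_class b J C)"
    using cube_hull_supporting_face[of "parity_class b J C" 0 "axis i 1"] unfolding * by (simp add: inner_axis_cube_vertex)
  show "cube_hull {A \<in> parity_class b J C. i \<in> A} face_of cube_hull (parity_class b J C)"
    using cube_hull_supporting_face[of "parity_class b J C" "-1" "axis i (-1)"] unfolding * by (simp add: inner_axis_cube_vertex)
qed

text \<open>Distances from \<open>W\<close> to the class are odd, so they are at least 1, with
  equality exactly at the neighbours; \<open>signs W\<close> is the supporting functional.\<close>

lemma face_of_nbrs:
  assumes W: "W \<in> parity_class (\<not> b) J C"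
  shows "cube_hull (nbrs J W) face_of cube_hull (parity_class b J C)"
proof -
  have c: "signs W \<bullet> cube_vertex A = real (card (sym_diff W A)) - real (card W)" for A
    using signs_cube_vertex[of W A] by linarith
  have *: "card (sym_diff W A) \<ge> 1" if "A \<in> parity_class b J C" for A
    using parity_class_sym_diff(2)[OF W that] by (cases "card (sym_diff W A)") auto
  have "A \<in> nbrs J W \<longleftrightarrow> signs W \<bullet> cube_vertex A = 1 - real (card W)" if "A \<in> parity_class b J C" for A
  proof -
    have "A - J = W - J" using W that by (auto simp: parity_class_def)
    then show ?thesis unfolding c by (simp add: mem_nbrs_card)
  qed
  then have "{A \<in> parity_class b J C. signs W \<bullet> cube_vertex A = 1 - real (card W)} = nbrs J W"
    using nbrs_subset[OF W] by auto
  moreover have "signs W \<bullet> cube_vertex A \<ge> 1 - real (card W)" if "A \<in> parity_class b J C" for A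
    unfolding c using *[OF that] by linarith
  ultimately show ?thesis
    using cube_hull_supporting_face[of "parity_class b J C" "1 - real (card W)" "signs W"] by simp
qed

text \<open>\<open>F\<close> is a face of \<open>G\<close> of the same dimension. Classifying a
  facet thus reduces to enclosing it in a known one.\<close>

lemma facet_subset_facet:
  assumes F: "F facet_of P" and G: "G facet_of P" and "F \<subseteq> G"
  shows "F = G"
proof (rule ccontr)
  assume "F \<noteq> G"
  have "F face_of G"
    using face_of_subset[OF facet_of_imp_face_of[OF F] \<open>F \<subseteq> G\<close> facet_of_imp_subset[OF G]] .
  then have "aff_dim F < aff_dim G"
    using face_of_aff_dim_lt \<open>F \<noteq> G\<close> face_of_imp_convex[OF facet_of_imp_face_of[OF G]] by blast
  then show False using F G by (simp add: facet_of_def)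
qed

section \<open>Classification of the facets in dimension at least four\<close>

context
  fixes J C :: "'n::finite set"
  assumes C: "C \<inter> J = {}" and J: "card J \<ge> 4"
begin

text \<open>With \<open>card J \<ge> 4\<close>, at least three free coordinates remain after
  removing one, so \<open>aff_dim_parity_class\<close> also gives the dimension of the face.\<close>

lemma facet_remove:
  assumes "i \<in> J"
  shows "cube_hull (parity_class b (J - {i}) C) facet_of cube_hull (parity_class b J C)"
    "cube_hull (parity_class b (J - {i}) (insert i C)) facet_of cube_hull (parity_class b J C)"
proof -
  have c: "card (J - {i}) = card J - 1" using assms by simp
  then have d: "aff_dim (cube_hull (parity_class b (J - {i}) D)) = int (card J) - 1" if "D \<inter> (J - {i}) = {}" for D
    using aff_dim_parity_class[OF that] J by simp
  have e: "aff_dim (cube_hull (parity_class b J C)) = int (card J)" using aff_dim_parity_class[OF C] J by simp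
  have ne: "parity_class b (J - {i}) D \<noteq> {}" if "D \<inter> (J - {i}) = {}" for D
    using card_parity_class[OF that, of b] c J by fastforce
  have CC: "C \<inter> (J - {i}) = {}" "insert i C \<inter> (J - {i}) = {}" using C by auto
  show "cube_hull (parity_class b (J - {i}) C) facet_of cube_hull (parity_class b J C)"
    unfolding facet_of_def using d[OF CC(1)] e ne[OF CC(1)] face_of_parity_class(1)[of b J C i]
    by (simp add: parity_class_remove(1)[OF assms C])
  show "cube_hull (parity_class b (J - {i}) (insert i C)) facet_of cube_hull (parity_class b J C)"
    unfolding facet_of_def using d[OF CC(2)] e ne[OF CC(2)] face_of_parity_class(2)[of b J C i]
    by (simp add: parity_class_remove(2)[OF assms C])
qed

lemma facet_nbrs:
  assumes W: "W \<in> parity_class (\<not> b) J C"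
  shows "cube_hull (nbrs J W) facet_of cube_hull (parity_class b J C)"
proof -
  have "nbrs J W \<noteq> {}" using card_nbrs[of J W] J by auto
  then show ?thesis
    unfolding facet_of_def using face_of_nbrs[OF W] aff_dim_nbrs[of J W] aff_dim_parity_class[OF C, of b] J
    by simp
qed

text \<open>If some free coordinate is constant on the vertices of the facet, a coordinate facet
  encloses it. Otherwise a functional maximized on the facet singles out a vertex \<open>W\<close>
  of the wrong parity, and the optimal vertices of the class are neighbours of
  \<open>W\<close>.\<close>

lemma facet_cases:
  assumes F: "F facet_of cube_hull (parity_class b J C)"
  obtains (zero) i where "i \<in> J" "F = cube_hull (parity_class b (J - {i}) C)"
    | (one) i where "i \<in> J" "F = cube_hull (parity_class b (J - {i}) (insert i C))"
    | (nbrs) W where "W \<in> parity_class (\<not> b) J C" "F = cube_hull (nbrs J W)"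
proof -
  let ?S = "parity_class b J C"
  define T where "T = {A \<in> ?S. cube_vertex A \<in> F}"
  have FT: "F = cube_hull T" unfolding T_def by (rule face_of_cube_hull[OF facet_of_imp_face_of[OF F]])
  show thesis
  proof (cases "\<exists>i\<in>J. (\<forall>A\<in>T. i \<notin> A) \<or> (\<forall>A\<in>T. i \<in> A)")
    case True
    then obtain i where i: "i \<in> J" "(\<forall>A\<in>T. i \<notin> A) \<or> (\<forall>A\<in>T. i \<in> A)" by blast
    then have "T \<subseteq> parity_class b (J - {i}) C \<or> T \<subseteq> parity_class b (J - {i}) (insert i C)"
      unfolding parity_class_remove[OF i(1) C] T_def by blast
    then show thesis
    proof
      assume "T \<subseteq> parity_class b (J - {i}) C"
      then have "F \<subseteq> cube_hull (parity_class b (J - {i}) C)" unfolding FT cube_hull_subset_iff .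
      then show thesis using facet_subset_facet[OF F facet_remove(1)[OF i(1)]] zero i by blast
    next
      assume "T \<subseteq> parity_class b (J - {i}) (insert i C)"
      then have "F \<subseteq> cube_hull (parity_class b (J - {i}) (insert i C))" unfolding FT cube_hull_subset_iff .
      then show thesis using facet_subset_facet[OF F facet_remove(2)[OF i(1)]] one i by blast
    qed
  next
    case False
    \<comment> \<open>Every face of a polyhedron is exposed, so \<open>F\<close> is where some
      functional \<open>a\<close> attains its maximum \<open>c\<close>.\<close>
    have "F exposed_face_of cube_hull ?S"
      using exposed_face_of_polyhedron[OF polytope_imp_polyhedron[OF polytope_cube_hull]]
        facet_of_imp_face_of[OF F] by blast
    then obtain a c where sub: "cube_hull ?S \<subseteq> {x. a \<bullet> x \<le> c}" and Fa: "F = cube_hull ?S \<inter> {x. a \<bullet> x = c}"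
      unfolding exposed_face_of_def by blast
    have le: "sum (($) a) A \<le> c" if "A \<in> ?S" for A
      using sub that cube_vertex_mem_cube_hull[of A ?S] unfolding inner_cube_vertex[symmetric] by blast
    have T: "A \<in> T \<longleftrightarrow> sum (($) a) A = c" if "A \<in> ?S" for A
      using that unfolding T_def Fa inner_cube_vertex[symmetric] by (simp add: cube_vertex_mem_cube_hull)
    \<comment> \<open>\<open>W\<close> maximizes \<open>a\<close> over all cube vertices of either parity, and \<open>m D\<close> is the loss caused
      by flipping the coordinates \<open>D\<close> of \<open>W\<close>; the vertices of \<open>F\<close> are those of least loss.\<close>
    define m where "m D = (\<Sum>i\<in>D. \<bar>a $ i\<bar>)" for D
    define W where "W = C \<union> {i\<in>J. a $ i > 0}"
    have WJ: "W - J = C" using C by (auto simp: W_def)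
    have m: "sum (($) a) A = sum (($) a) W - m (sym_diff A W)" if "A \<in> ?S" for A
    proof -
      have AJ: "A - J = C" using that by (simp add: parity_class_def)
      have "sum (($) a) A = sum (($) a) (A \<inter> W) + sum (($) a) (A - W)"
        by (simp add: sum.Int_Diff)
      moreover have "sum (($) a) W = sum (($) a) (A \<inter> W) + sum (($) a) (W - A)"
        using sum.Int_Diff[of W "($) a" A] by (simp add: Int_commute)
      moreover have "m (sym_diff A W) = m (A - W) + m (W - A)"
        unfolding m_def by (rule sum.union_disjoint) auto
      moreover have "m (A - W) = - sum (($) a) (A - W)"
        unfolding m_def sum_negf[symmetric] using AJ by (intro sum.cong) (auto simp: W_def)
      moreover have "m (W - A) = sum (($) a) (W - A)"
        unfolding m_def using AJ by (intro sum.cong) (auto simp: W_def)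
      ultimately show ?thesis by simp
    qed
    have opt: "m (sym_diff A W) \<le> m (sym_diff B W)" if "A \<in> T" "B \<in> ?S" for A B
    proof -
      have "A \<in> ?S" using that by (simp add: T_def)
      then show ?thesis using that T[of A] le[of B] m[of A] m[of B] by simp
    qed
    \<comment> \<open>Each free coordinate takes both values on \<open>T\<close>, so some vertex of
      \<open>F\<close> differs from \<open>W\<close> there.\<close>
    have hit: "\<exists>A\<in>T. i \<in> sym_diff A W" if "i \<in> J" for i
      using False that by blast
    \<comment> \<open>A vertex of the class without loss would make all of \<open>T\<close>
      lossless. By \<open>hit\<close>, \<open>a\<close> would then vanish on \<open>J\<close>, and
      \<open>F\<close> would be the whole polytope.\<close>
    have nz: "m (sym_diff B W) \<noteq> 0" if B: "B \<in> ?S" for B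
    proof
      assume 0: "m (sym_diff B W) = 0"
      have a0: "a $ i = 0" if "i \<in> J" for i
      proof -
        obtain A where A: "A \<in> T" "i \<in> sym_diff A W" using hit[OF \<open>i \<in> J\<close>] by blast
        then have "\<bar>a $ i\<bar> \<le> m (sym_diff A W)"
          unfolding m_def by (intro member_le_sum) auto
        then show ?thesis using opt[OF A(1) B] 0 by simp
      qed
      have "m (sym_diff A W) = 0" if "A \<in> ?S" for A
      proof -
        have "sym_diff A W \<subseteq> J" using that WJ by (auto simp: parity_class_def)
        then show ?thesis unfolding m_def by (intro sum.neutral) (use a0 in auto)
      qed
      moreover have "T \<noteq> {}" using F FT by (auto simp: facet_of_def)
      moreover have "T \<subseteq> ?S" by (auto simp: T_def)
      ultimately have "T = ?S" using T m by (metis subset_antisym ex_in_conv subsetD subsetI)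
      then show False using F FT by simp
    qed
    have mz: "m {} = 0" by (simp add: m_def)
    have "W \<notin> ?S" using nz[of W] mz by auto
    then have W: "W \<in> parity_class (\<not> b) J C" using WJ by (auto simp: parity_class_def)
    have flip: "sym_diff W {i} \<in> ?S" if "i \<in> J" for i
      using parity_class_flip[OF W, of "{i}"] that by simp
    have flip': "sym_diff (sym_diff W {i}) W = {i}" for i by blast
    \<comment> \<open>A single flip of \<open>W\<close> lands in the class, where the loss cannot
      vanish.\<close>
    have pos: "\<bar>a $ i\<bar> > 0" if "i \<in> J" for i
      using nz[OF flip[OF that]] unfolding flip' m_def by simp
    have "A \<in> nbrs J W" if A: "A \<in> T" for A
    proof -
      have AS: "A \<in> ?S" using A by (simp add: T_def)
      have sJ: "sym_diff A W \<subseteq> J" and od: "odd (card (sym_diff A W))"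
        using parity_class_sym_diff[OF AS W] by blast+
      then obtain i where i: "i \<in> sym_diff A W" by (metis card.empty even_zero ex_in_conv)
      then have "i \<in> J" using sJ by blast
      \<comment> \<open>A second flipped coordinate \<open>j\<close> would cost a further positive
        amount over flipping \<open>i\<close> alone.\<close>
      have "sym_diff A W = {i}"
      proof (rule ccontr)
        assume "sym_diff A W \<noteq> {i}"
        then obtain j where j: "j \<in> sym_diff A W" "j \<noteq> i" using i by blast
        have "\<bar>a $ i\<bar> + \<bar>a $ j\<bar> = m {i, j}" using j by (simp add: m_def)
        also have "\<dots> \<le> m (sym_diff A W)" unfolding m_def using i j by (intro sum_mono2) auto
        also have "\<dots> \<le> m {i}" using opt[OF A flip[OF \<open>i \<in> J\<close>]] unfolding flip' .
        finally have "\<bar>a $ j\<bar> \<le> 0" by (simp add: m_def)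
        then show False using pos[of j] j(1) sJ by auto
      qed
      then show ?thesis unfolding mem_nbrs_iff using \<open>i \<in> J\<close> by blast
    qed
    then have "F \<subseteq> cube_hull (nbrs J W)" unfolding FT cube_hull_subset_iff by blast
    then show thesis using facet_subset_facet[OF F facet_nbrs[OF W]] nbrs W by blast
  qed
qed

text \<open>The \<open>2 ^ (card J - 1)\<close> extreme points are too many for a simplex of
  dimension \<open>card J\<close>.\<close>

lemma not_simplex_parity_class: "\<not> n simplex cube_hull (parity_class b J C)"
proof
  assume "n simplex cube_hull (parity_class b J C)"
  then obtain V where V: "\<not> affine_dependent V" "cube_hull (parity_class b J C) = convex hull V"
    unfolding simplex_def by blast
  have "V = cube_vertex ` parity_class b J C"
    using extreme_point_of_cube_hull[of _ "parity_class b J C"] extreme_point_of_convex_hull_affine_independent[OF V(1)]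
    unfolding V(2) by blast
  then have "card V = card (parity_class b J C)"
    using card_image[OF inj_on_subset[OF inj_cube_vertex subset_UNIV]] by metis
  also have "\<dots> = 2 ^ (card J - 1)" using J by (intro card_parity_class C) auto
  finally have "card V = 2 ^ (card J - 1)" .
  moreover have "int (card V) = int (card J) + 1"
    using aff_dim_affine_independent[OF V(1)] aff_dim_parity_class[OF C, of b] J
    unfolding V(2) aff_dim_convex_hull by simp
  moreover have "k + 1 < 2 ^ (k - 1)" if "k \<ge> 4" for k :: nat
    using that
  proof (induction k rule: nat_induct_at_least)
    case (Suc k)
    then obtain m where "k = Suc m" by (metis Suc_le_D numeral_eq_Suc)
    then show ?case using Suc by simp
  qed simp
  ultimately show False using J by (metis less_irrefl of_nat_1 of_nat_add of_nat_eq_iff)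
qed

section \<open>Facets that avoid a given vertex\<close>

context
  fixes A\<^sub>0 :: "'n set" and b :: bool
  assumes A\<^sub>0: "A\<^sub>0 \<in> parity_class b J C"
begin

definition opposite :: "'n \<Rightarrow> 'n set set" where
  "opposite i = parity_class b (J - {i}) (if i \<in> A\<^sub>0 then C else insert i C)"

lemma mem_opposite: "i \<in> J \<Longrightarrow> A \<in> opposite i \<longleftrightarrow> A \<in> parity_class b J C \<and> i \<in> sym_diff A\<^sub>0 A"
  unfolding opposite_def using parity_class_remove[OF _ C, of i b] by (cases "i \<in> A\<^sub>0") simp_all

text \<open>Flipping \<open>i\<close> and a third coordinate \<open>k\<close> in
  \<open>A\<^sub>0\<close> preserves parity and gives a vertex that lies opposite in direction
  \<open>i\<close> but not in direction \<open>j\<close>.\<close>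

lemma inj_on_opposite: "inj_on opposite J"
proof (rule inj_onI, rule ccontr)
  fix i j assume ij: "i \<in> J" "j \<in> J" "opposite i = opposite j" "i \<noteq> j"
  have "\<not> J \<subseteq> {i, j}" using J card_mono[of "{i, j}" J] ij(4) by auto
  then obtain k where k: "k \<in> J" "k \<noteq> i" "k \<noteq> j" by blast
  let ?A = "sym_diff A\<^sub>0 {i, k}"
  have "even (card {i, k})" using k by simp
  then have "?A \<in> parity_class b J C"
    using A\<^sub>0 ij(1) k(1) unfolding parity_class_def mem_Collect_eq even_card_sym_diff by blast
  then have "?A \<in> opposite i" "?A \<notin> opposite j"
    using ij(1,2,4) k by (simp_all add: mem_opposite)
  then show False using ij(3) by simp
qed

text \<open>Coordinate \<open>i\<close> is constant on \<open>opposite i\<close>, but takes both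
  values on the neighbours of \<open>W\<close>.\<close>

lemma opposite_neq_nbrs:
  assumes "i \<in> J"
  shows "opposite i \<noteq> nbrs J W"
proof
  assume eq: "opposite i = nbrs J W"
  have "J \<noteq> {i}" using J by auto
  then obtain j where j: "j \<in> J" "j \<noteq> i" using assms by blast
  have "sym_diff W {i} \<in> opposite i" "sym_diff W {j} \<in> opposite i"
    unfolding eq nbrs_def using assms j by blast+
  then show False using j(2) unfolding mem_opposite[OF assms] by blast
qed

text \<open>If the neighbours coincide, flipping any \<open>i\<close> in \<open>J\<close> turns the
  difference \<open>?D\<close> into a singleton. For \<open>?D = J\<close> this leaves too many
  elements; otherwise adding a missing \<open>i\<close> shows that \<open>?D\<close> is
  empty.\<close>

lemma inj_on_nbrs: "inj_on (nbrs J) (parity_class b' J C)"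
proof (rule inj_onI, rule ccontr)
  fix V W assume V: "V \<in> parity_class b' J C" and W: "W \<in> parity_class b' J C"
    and eq: "nbrs J V = nbrs J W" and "V \<noteq> W"
  let ?D = "sym_diff V W"
  have "?D \<noteq> {}" using \<open>V \<noteq> W\<close> by blast
  have c: "card (sym_diff ?D {i}) = 1" if "i \<in> J" for i
  proof -
    have "sym_diff V {i} \<in> nbrs J W" using that eq unfolding nbrs_def by blast
    then obtain j where "sym_diff (sym_diff V {i}) W = {j}" unfolding mem_nbrs_iff by blast
    moreover have "sym_diff (sym_diff V {i}) W = sym_diff ?D {i}" by blast
    ultimately have "sym_diff ?D {i} = {j}" by (rule back_subst)
    then show ?thesis unfolding One_nat_def card_1_singleton_iff by blast
  qed
  have "?D \<subseteq> J" using parity_class_sym_diff(1)[OF V W] .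
  show False
  proof (cases "?D = J")
    case True
    obtain i where "i \<in> J" using J by fastforce
    moreover from this have "sym_diff ?D {i} = J - {i}" unfolding True by blast
    ultimately show False using c[of i] J by simp
  next
    case False
    then obtain i where i: "i \<in> J" "i \<notin> ?D" using \<open>?D \<subseteq> J\<close> by blast
    then have "sym_diff ?D {i} = insert i ?D" by blast
    then have "card ?D = 0" using c[OF i(1)] i(2) by simp
    then show False using \<open>?D \<noteq> {}\<close> by simp
  qed
qed

lemma facets_avoiding:
  "{F. F facet_of cube_hull (parity_class b J C) \<and> cube_vertex A\<^sub>0 \<notin> F} =
    cube_hull ` (opposite ` J \<union> nbrs J ` (parity_class (\<not> b) J C - nbrs J A\<^sub>0))"
proof -
  \<comment> \<open>Adjacency is symmetric, so the simplex facets through \<open>A\<^sub>0\<close>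
    are those belonging to its own neighbours.\<close>
  have nb: "A\<^sub>0 \<in> nbrs J W \<longleftrightarrow> W \<in> nbrs J A\<^sub>0" for W
    unfolding mem_nbrs_iff by (simp only: Un_commute)
  have A\<^sub>0_opp: "A\<^sub>0 \<notin> opposite i" if "i \<in> J" for i using mem_opposite[OF that] by blast
  show ?thesis
  proof (intro subset_antisym subsetI)
    fix F assume "F \<in> {F. F facet_of cube_hull (parity_class b J C) \<and> cube_vertex A\<^sub>0 \<notin> F}"
    then have F: "F facet_of cube_hull (parity_class b J C)" and nF: "cube_vertex A\<^sub>0 \<notin> F" by auto
    show "F \<in> cube_hull ` (opposite ` J \<union> nbrs J ` (parity_class (\<not> b) J C - nbrs J A\<^sub>0))"
      using F
    proof (cases rule: facet_cases)
      case (zero i)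
      then have "i \<in> A\<^sub>0" using nF A\<^sub>0 by (auto simp: cube_vertex_mem_cube_hull parity_class_remove[OF _ C])
      then have "F = cube_hull (opposite i)" using zero by (simp add: opposite_def)
      then show ?thesis using zero by blast
    next
      case (one i)
      then have "i \<notin> A\<^sub>0" using nF A\<^sub>0 by (auto simp: cube_vertex_mem_cube_hull parity_class_remove[OF _ C])
      then have "F = cube_hull (opposite i)" using one by (simp add: opposite_def)
      then show ?thesis using one by blast
    next
      case (nbrs W)
      then have "W \<notin> nbrs J A\<^sub>0" using nF nb[of W] by (simp add: cube_vertex_mem_cube_hull)
      then show ?thesis using nbrs by blast
    qed
  next
    fix F assume "F \<in> cube_hull ` (opposite ` J \<union> nbrs J ` (parity_class (\<not> b) J C - nbrs J A\<^sub>0))"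
    then consider i where "i \<in> J" "F = cube_hull (opposite i)"
      | W where "W \<in> parity_class (\<not> b) J C" "W \<notin> nbrs J A\<^sub>0" "F = cube_hull (nbrs J W)" by blast
    then show "F \<in> {F. F facet_of cube_hull (parity_class b J C) \<and> cube_vertex A\<^sub>0 \<notin> F}"
    proof cases
      case 1
      then have "F facet_of cube_hull (parity_class b J C)"
        using facet_remove[OF 1(1), of b] by (simp add: opposite_def)
      then show ?thesis using 1 A\<^sub>0_opp by (simp add: cube_vertex_mem_cube_hull)
    next
      case 2
      then show ?thesis using facet_nbrs nb by (simp add: cube_vertex_mem_cube_hull)
    qed
  qed
qed

lemma sum_facets_avoiding:
  "(\<Sum>F | F facet_of cube_hull (parity_class b J C) \<and> cube_vertex A\<^sub>0 \<notin> F. f F) =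
    (\<Sum>i\<in>J. f (cube_hull (opposite i))) + (\<Sum>W\<in>parity_class (\<not> b) J C - nbrs J A\<^sub>0. f (cube_hull (nbrs J W)))"
  for f :: "_ \<Rightarrow> nat"
proof -
  have "inj cube_hull" by (rule injI) (simp only: cube_hull_eq_iff)
  then have "(\<Sum>F | F facet_of cube_hull (parity_class b J C) \<and> cube_vertex A\<^sub>0 \<notin> F. f F) =
      (\<Sum>S\<in>opposite ` J \<union> nbrs J ` (parity_class (\<not> b) J C - nbrs J A\<^sub>0). f (cube_hull S))"
    unfolding facets_avoiding by (subst sum.reindex) (auto intro: inj_on_subset)
  also have "\<dots> = (\<Sum>S\<in>opposite ` J. f (cube_hull S)) + (\<Sum>S\<in>nbrs J ` (parity_class (\<not> b) J C - nbrs J A\<^sub>0). f (cube_hull S))"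
    using opposite_neq_nbrs by (intro sum.union_disjoint) auto
  finally show ?thesis
    using sum.reindex[OF inj_on_opposite, of "\<lambda>S. f (cube_hull S)"]
      sum.reindex[OF inj_on_subset[OF inj_on_nbrs[of "\<not> b"] Diff_subset], of "\<lambda>S. f (cube_hull S)" "nbrs J A\<^sub>0"]
    by simp
qed

lemma card_not_nbrs: "card (parity_class (\<not> b) J C - nbrs J A\<^sub>0) + card J = 2 ^ (card J - 1)"
proof -
  have "J \<noteq> {}" using J by auto
  then show ?thesis
    using card_Diff_subset[OF _ nbrs_subset[OF A\<^sub>0]] card_mono[OF _ nbrs_subset[OF A\<^sub>0]]
      card_parity_class[OF C, of "\<not> b"] card_nbrs[of J A\<^sub>0] by simp
qed

end

end

section \<open>The recursion for the number of simplices\<close>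

lemma pull_independent:
  assumes "\<not> affine_dependent (cube_vertex ` S)"
  shows "pull r (cube_hull S) = {cube_hull S}"
  using assms by (intro pull_simplex[of "int (card (cube_vertex ` S)) - 1"]) (auto simp: simplex_def)

text \<open>Four points spanning dimension three form a tetrahedron, the base case of the
  induction.\<close>

lemma pull_parity_class_3:
  assumes "C \<inter> J = {}" "card J = 3"
  shows "pull r (cube_hull (parity_class b J C)) = {cube_hull (parity_class b J C)}"
proof (rule pull_independent)
  have "J \<noteq> {}" using assms by auto
  have "card (cube_vertex ` parity_class b J C) = card (parity_class b J C)"
    by (rule card_image[OF inj_on_subset[OF inj_cube_vertex subset_UNIV]])
  also have "\<dots> = 4" using card_parity_class[OF assms(1) \<open>J \<noteq> {}\<close>] assms(2) by simp
  finally show "\<not> affine_dependent (cube_vertex ` parity_class b J C)"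
    using aff_dim_parity_class[OF assms(1), of b] assms(2)
    unfolding affine_independent_iff_card aff_dim_convex_hull by simp
qed

lemma card_pull_parity_class:
  assumes "card J = k" "k \<ge> 3" "C \<inter> J = {}" "unique_minima r (cube_hull (parity_class b J C))"
  shows "finite (pull r (cube_hull (parity_class b J C))) \<and>
    real (card (pull r (cube_hull (parity_class b J C)))) = (\<Sum>l = 3..k. fact k / fact l * (2 ^ (l - 1) - real l))"
  using assms(2,1,3,4)
proof (induction k arbitrary: J C rule: nat_induct_at_least)
  case base
  then show ?case by (simp add: pull_parity_class_3)
next
  case (Suc k)
  note um = \<open>unique_minima r (cube_hull (parity_class b J C))\<close>
  note C = \<open>C \<inter> J = {}\<close>
  define t where "t k = (\<Sum>l = 3..k. fact k / fact l * (2 ^ (l - 1) - real l))" for k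
  let ?P = "cube_hull (parity_class b J C)"
  have J: "card J \<ge> 4" and "J \<noteq> {}" using Suc by auto
  have "?P \<noteq> {}" using parity_class_nonempty[OF C \<open>J \<noteq> {}\<close>, of b] by auto
  \<comment> \<open>The order enters only through this choice of \<open>A\<close>, and the facet
    counts below are the same for every \<open>A\<close>.\<close>
  then obtain A where A: "pulled_vertex r ?P = cube_vertex A" "A \<in> parity_class b J C"
    using pulled_vertex_extreme[OF um] extreme_point_of_cube_hull[of _ "parity_class b J C"] by auto
  let ?opp = "opposite J C A b"
  have opp: "finite (pull r (cube_hull (?opp i))) \<and> real (card (pull r (cube_hull (?opp i)))) = t k" if "i \<in> J" for i
  proof -
    let ?C = "if i \<in> A then C else insert i C"
    have face: "cube_hull (?opp i) face_of ?P"
      using facet_remove[OF C J that, of b] facet_of_imp_face_of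
      unfolding opposite_def[OF C J A(2)] by auto
    have "unique_minima r (cube_hull (parity_class b (J - {i}) ?C))"
      using unique_minima_face[OF um face] unfolding opposite_def[OF C J A(2)] .
    moreover have "card (J - {i}) = k" "?C \<inter> (J - {i}) = {}" using Suc.prems C that by auto
    ultimately show ?thesis
      using Suc.IH[of "J - {i}" ?C] unfolding opposite_def[OF C J A(2)] t_def by blast
  qed
  have nbrs: "pull r (cube_hull (nbrs J W)) = {cube_hull (nbrs J W)}" for W
    by (rule pull_independent[OF affine_independent_nbrs])
  have fin: "finite (pull r F)" if "F facet_of ?P" "pulled_vertex r ?P \<notin> F" for F
  proof -
    have "F \<in> cube_hull ` (?opp ` J \<union> nbrs J ` (parity_class (\<not> b) J C - nbrs J A))"
      using facets_avoiding[OF C J A(2)] that unfolding A(1) by blast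
    then show ?thesis using opp nbrs by auto
  qed
  have ns: "\<nexists>n. n simplex ?P" using not_simplex_parity_class[OF C J] by blast
  note cp = card_pull[OF polytope_cube_hull um ns fin]
  have "card (pull r ?P) = (\<Sum>i\<in>J. card (pull r (cube_hull (?opp i)))) + card (parity_class (\<not> b) J C - nbrs J A)"
    using cp(2) sum_facets_avoiding[OF C J A(2), of "\<lambda>F. card (pull r F)"] unfolding A(1) nbrs by simp
  then have "real (card (pull r ?P)) =
      (\<Sum>i\<in>J. real (card (pull r (cube_hull (?opp i))))) + real (card (parity_class (\<not> b) J C - nbrs J A))"
    by simp
  also have "(\<Sum>i\<in>J. real (card (pull r (cube_hull (?opp i))))) = real (Suc k) * t k"
    using opp Suc.prems(1) by simp
  also have "real (card (parity_class (\<not> b) J C - nbrs J A)) = 2 ^ k - real (Suc k)"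
    using arg_cong[OF card_not_nbrs[OF C J A(2)], of real] Suc.prems(1) by simp
  also have "real (Suc k) * t k + (2 ^ k - real (Suc k)) = t (Suc k)"
  proof -
    \<comment> \<open>The factor \<open>Suc k\<close> is absorbed into the factorial; the remaining
      \<open>2 ^ k - Suc k\<close> is the summand for \<open>l = Suc k\<close>, where the quotient
      of factorials is 1.\<close>
    have "real (Suc k) * t k = (\<Sum>l = 3..k. fact (Suc k) / fact l * (2 ^ (l - 1) - real l))"
      unfolding t_def sum_distrib_left by (intro sum.cong refl) (simp add: fact_Suc del: of_nat_Suc)
    then show ?thesis unfolding t_def using Suc.hyps by (simp add: sum.cl_ivl_Suc)
  qed
  finally show ?case using cp(1) unfolding t_def by simp
qed

text \<open>All coordinates are free, and the coordinate sum of \<open>cube_vertex A\<close> is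
  \<open>card A\<close>, so the two parity conditions agree.\<close>

lemma halfcube_eq: "(halfcube :: (real ^ 'n) set) = cube_hull (parity_class True UNIV {})"
proof -
  have "{p :: real ^ 'n. (\<forall>i. p $ i \<in> {0, 1}) \<and> (\<exists>m::nat. even m \<and> (\<Sum>i\<in>UNIV. p $ i) = real m)} =
      cube_vertex ` parity_class True UNIV {}" (is "?L = ?R")
  proof (intro subset_antisym subsetI)
    have card: "(\<Sum>i\<in>UNIV. cube_vertex A $ i) = real (card A)" for A :: "'n set"
      by (simp add: sum.If_cases)
    {
      fix p assume p: "p \<in> ?L"
      define A where "A = {i. p $ i = 1}"
      have "p = cube_vertex A" using p unfolding A_def vec_eq_iff by fastforce
      then show "p \<in> ?R" using p card[of A] by (auto simp: parity_class_def)
    }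
    fix p assume "p \<in> ?R"
    then obtain A where "p = cube_vertex A" "even (card A)" by (auto simp: parity_class_def)
    then show "p \<in> ?L" using card[of A] by (auto simp del: cube_vertex_nth) (auto)
  qed
  then show ?thesis unfolding halfcube_def by simp
qed

theorem theorem3p1:
  fixes r :: "(real ^ 'n) rel" and d :: nat
  assumes "d = CARD('n)" and "d \<ge> 3"
    and "pulling_order (halfcube :: (real ^ 'n) set) r"
  shows "finite (pull r (halfcube :: (real ^ 'n) set)) \<and>
    real (card (pull r (halfcube :: (real ^ 'n) set))) =
      (\<Sum>l = 3..d. fact d / fact l * (2 ^ (l - 1) - real l))"
proof -
  have "unique_minima r (halfcube :: (real ^ 'n) set)"
    using assms(3) unfolding pulling_order_def unique_minima_def by blast
  then show ?thesis
    using card_pull_parity_class[of "UNIV :: 'n set" d "{}" r True] assms(1,2) unfolding halfcube_eq by simp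
qed

end
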